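(* Let $p\ge 2$ and $n\ge 0$ be integers. Then $C_{\Gamma_n^{(p)}}(x)$ is of degree $\left\lfloor \frac{(n+1)(p-1)}{p}\right\rfloor$. Moreover $$C_{\Gamma_n^{(p)}}(x)=\sum_{a = 0}^{\left\lfloor \frac{(n+1)(p-1)}{p}\right\rfloor}\binom{n-a+1}{a}_{p-1}(1+x)^{a}$$ and $$D_{\Gamma_n^{(p)}}(x,q)=\sum_{a = 0}^{\left\lfloor \frac{(n+1)(p-1)}{p}\right\rfloor}\binom{n-a+1}{a}_{p-1}(x+q)^{a}.$$ For every integer $k\ge 0$, the number of induced subgraphs of $\Gamma_n^{(p)}$ isomorphic to $Q_k$ is $$c_{k}(\Gamma_n^{(p)})=\sum_{a = k}^{\left\lfloor \frac{(n+1)(p-1)}{p}\right\rfloor}\binom{n-a+1}{a}_{p-1} \binom{a}{k},$$ and, for all integers $k,d\ge 0$ with $d+k\le n+1$, the number of those at distance $d$ from $0^n$ (that is, with bottom vertex at distance $d$ from $0^n$) is $$c_{k,d}(\Gamma_n^{(p)})=\binom{n-d-k+1}{d+k}_{p-1} \binom{d+k}{k}.$$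
   Context: For an integer $n\ge 0$, the hypercube $Q_n$ has vertex set $\{0,1\}^n$ (binary strings of length $n$; for $n=0$ only the empty string), two strings being adjacent iff they differ in exactly one coordinate. For $p\ge2$, a $p$-th order Fibonacci string is a binary string that does not contain $1^p$ ($p$ consecutive 1s) as a substring (of consecutive letters). $\Gamma_n^{(p)}$ is the subgraph of $Q_n$ induced by the $p$-th order Fibonacci strings of length $n$; in particular $\Gamma_0^{(p)}=K_1$. The weight of a binary string is its number of 1s. For a graph $G$, $c_k(G)$ is the number of induced subgraphs of $G$ isomorphic to $Q_k$, and the cube polynomial is $C_G(x)=\sum_{k\ge0}c_k(G)x^k$. An induced subgraph $H$ of $Q_n$ isomorphic to some $Q_k$ has a unique vertex of minimal weight, called its bottom vertex. For an induced subgraph $G$ of $Q_n$ containing $0^n$, $c_{k,d}(G)$ is the number of induced subgraphs of $G$ isomorphic to $Q_k$ whose bottom vertex is at distance $d$ from $0^n$, and the distance cube polynomial is $D_G(x,q)=\sum_{k,d\ge 0}c_{k,d}(G)x^kq^d$. For integers $p\ge2$, $b\ge 0$ and $a$, the $p$-nomial coefficient $\binom{b}{a}_{p-1}$ is the coefficient of $x^a$ in $(1+x+x^2+\dots+x^{p-1})^b$ (so it is $0$ for $a<0$ or $a>b(p-1)$); $\binom{a}{k}$ is the ordinary binomial coefficient. Sums whose lower limit exceeds the upper limit are $0$. *)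

theory Defs
  imports
    "Graph_Theory.Graph_Theory"
    "HOL-Library.Sublist"
    "HOL-Library.Groups_Big_Fun"
    "HOL-Computational_Algebra.Polynomial"
begin

text \<open>
  Binary strings are lists of booleans, \<^term>\<open>True\<close> being the letter 1. Undirected graphs
  are symmetric digraphs whose arcs are pairs of vertices, as usual in the Graph Theory entry.
\<close>

type_synonym string_graph = "(bool list, bool list \<times> bool list) pre_digraph"

definition hypercube :: "nat \<Rightarrow> string_graph" where
  "hypercube n = with_proj
     \<lparr> pverts = {w. length w = n},
       parcs = {(u, v). length u = n \<and> length v = n \<and> card {i. i < n \<and> u ! i \<noteq> v ! i} = 1} \<rparr>"

definition fib_string :: "nat \<Rightarrow> bool list \<Rightarrow> bool" where
  "fib_string p w \<longleftrightarrow> \<not> sublist (replicate p True) w"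

definition fib_cube :: "nat \<Rightarrow> nat \<Rightarrow> string_graph" where
  "fib_cube p n = hypercube n \<restriction> {w \<in> verts (hypercube n). fib_string p w}"

definition weight :: "bool list \<Rightarrow> nat" where
  "weight w = count_list w True"

definition zero_string :: "nat \<Rightarrow> bool list" where
  "zero_string n = replicate n False"

text \<open>
  Subgraphs in the library keep the incidence functions of the ambient graph, so an
  induced subgraph is determined by its vertex set and the cardinalities below count
  induced subgraphs, not representations of them.
\<close>

definition induced_cubes :: "string_graph \<Rightarrow> nat \<Rightarrow> string_graph set" where
  "induced_cubes G k = {H. induced_subgraph H G \<and> digraph_iso H (hypercube k)}"

definition cube_count :: "string_graph \<Rightarrow> nat \<Rightarrow> nat" where
  "cube_count G k = card (induced_cubes G k)"

definition bottom_vertex :: "string_graph \<Rightarrow> bool list" where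
  "bottom_vertex H = (THE v. is_arg_min weight (\<lambda>u. u \<in> verts H) v)"

text \<open>The graph distance is the library's shortest path distance with all arcs of cost 1;
  it is infinite between different components.\<close>

definition graph_dist :: "string_graph \<Rightarrow> bool list \<Rightarrow> bool list \<Rightarrow> ereal" where
  "graph_dist G u v = wf_digraph.\<mu> G (\<lambda>_. 1) u v"

text \<open>In the next definition, and in that of the distance cube polynomial, \<open>G\<close> is meant to be
  an induced subgraph of \<^term>\<open>hypercube n\<close> that contains \<^term>\<open>zero_string n\<close>.\<close>

definition cube_dist_count :: "nat \<Rightarrow> string_graph \<Rightarrow> nat \<Rightarrow> nat \<Rightarrow> nat" where
  "cube_dist_count n G k d =
     card {H \<in> induced_cubes G k. graph_dist G (zero_string n) (bottom_vertex H) = ereal (real d)}"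

text \<open>\<^const>\<open>Sum_any\<close> sums over all natural numbers; for finite graphs only finitely many
  summands are nonzero.\<close>

definition cube_poly :: "string_graph \<Rightarrow> int poly" where
  "cube_poly G = Sum_any (\<lambda>k. monom (int (cube_count G k)) k)"

text \<open>
  Polynomials in \<open>x\<close> and \<open>q\<close> are polynomials in \<open>x\<close> whose coefficients are
  polynomials in \<open>q\<close>; thus \<open>c x\<^sup>k q\<^sup>d\<close> is \<^term>\<open>monom (monom c d) k\<close>.
\<close>

definition var_x :: "int poly poly" where
  "var_x = monom 1 1"

definition var_q :: "int poly poly" where
  "var_q = [: monom 1 1 :]"

definition dist_cube_poly :: "nat \<Rightarrow> string_graph \<Rightarrow> int poly poly" where
  "dist_cube_poly n G =
     Sum_any (\<lambda>k. Sum_any (\<lambda>d. of_nat (cube_dist_count n G k d) * var_x ^ k * var_q ^ d))"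

text \<open>The \<open>p\<close>-nomial coefficient, usually written with subscript \<open>p - 1\<close>.\<close>

definition pnomial :: "nat \<Rightarrow> nat \<Rightarrow> nat \<Rightarrow> nat" where
  "pnomial p b a = coeff ((\<Sum>i<p. monom 1 i) ^ b) a"

lemma graph_hypercube: "graph (hypercube n)"
proof -
  have fin: "finite {w :: bool list. length w = n}"
    using finite_lists_length_eq[of "UNIV :: bool set" n] by simp
  have fin_arcs: "finite {(u, v :: bool list). length u = n \<and> length v = n
      \<and> card {i. i < n \<and> u ! i \<noteq> v ! i} = 1}"
    by (rule finite_subset[OF _ finite_cartesian_product[OF fin fin]]) auto
  have not_sym_eq: "(x \<noteq> y) = (y \<noteq> x)" for x y :: bool
    by blast
  have swap: "card {i. i < n \<and> v ! i \<noteq> u ! i} = card {i. i < n \<and> u ! i \<noteq> v ! i}"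
    for u v :: "bool list"
    by (intro arg_cong[of _ _ card] Collect_cong conj_cong refl not_sym_eq)
  have ends: "arcs_ends (hypercube n) = {(u, v). length u = n \<and> length v = n
      \<and> card {i. i < n \<and> u ! i \<noteq> v ! i} = 1}"
    by (simp add: hypercube_def with_proj_def arcs_ends_conv)
  show ?thesis
  proof
    show "symmetric (hypercube n)"
      unfolding symmetric_def ends sym_def mem_Collect_eq prod.case
    proof (intro allI impI, elim conjE, intro conjI)
      fix u v :: "bool list"
      assume "card {i. i < n \<and> u ! i \<noteq> v ! i} = 1"
      then show "card {i. i < n \<and> v ! i \<noteq> u ! i} = 1"
        by (rule trans[OF swap])
    qed
  next
    fix e1 e2 assume "arc_to_ends (hypercube n) e1 = arc_to_ends (hypercube n) e2"
    then show "e1 = e2"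
      by (simp add: hypercube_def with_proj_def arc_to_ends_def prod_eq_iff)
  next
    fix e assume e: "e \<in> arcs (hypercube n)"
    show "tail (hypercube n) e \<in> verts (hypercube n)" "head (hypercube n) e \<in> verts (hypercube n)"
      using e by (auto simp: hypercube_def with_proj_def)
    show "tail (hypercube n) e \<noteq> head (hypercube n) e"
    proof
      assume "tail (hypercube n) e = head (hypercube n) e"
      then have "fst e = snd e"
        by (simp add: hypercube_def with_proj_def)
      moreover have "card {i. i < n \<and> fst e ! i \<noteq> snd e ! i} = 1"
        using e by (simp add: hypercube_def with_proj_def case_prod_beta)
      ultimately show False
        by simp
    qed
  next
    show "finite (verts (hypercube n))" "finite (arcs (hypercube n))"
      using fin fin_arcs by (simp_all add: hypercube_def with_proj_def)
  qed
qed

lemma wf_fib_cube: "wf_digraph (fib_cube p n)"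
proof -
  interpret graph "hypercube n" by (rule graph_hypercube)
  show ?thesis
    unfolding fib_cube_def by (rule wellformed_induce_subgraph)
qed

end

theory Submission
  imports Defs
begin

text \<open>
  Read a string as the set of positions of its 1s. An induced subgraph isomorphic to a
  \<open>k\<close>-cube is then an interval \<open>{X. B \<subseteq> X \<subseteq> T}\<close> with \<open>T - B\<close> of size \<open>k\<close>: a map of hypercubes
  that is injective and preserves adjacency sends each direction of its domain to one fixed
  coordinate of its target, because a square cannot be folded (\<open>hypercube_embedding\<close>, \<open>verts_of_hypercube_copy\<close>).

  Fibonacci strings form a down-closed family, so such an interval lies in the Fibonacci cube
  as soon as its top \<open>T\<close> is Fibonacci. A Fibonacci string of weight \<open>a\<close> is therefore the top of
  exactly \<open>a choose k\<close> cubes of dimension \<open>k\<close>, obtained by choosing \<open>T - B\<close> within \<open>T\<close>. Their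
  bottom \<open>B\<close> has weight \<open>a - k\<close>, and this is also its distance from \<open>0\<^sup>n\<close> because its 1s can
  be removed one by one inside the family. Summing over \<open>k\<close> with the binomial theorem, a vertex
  of weight \<open>a\<close> contributes \<open>(1 + x)\<^sup>a\<close> to the cube polynomial and \<open>(x + q)\<^sup>a\<close> to the
  distance cube polynomial (\<open>cube_poly_daisy\<close>, \<open>dist_cube_poly_daisy\<close>).

  It remains to count the Fibonacci strings of length \<open>n\<close> and weight \<open>a\<close>. After a 0 is appended,
  such a string is a unique sequence of \<open>n + 1 - a\<close> blocks \<open>1\<^sup>i0\<close> with \<open>i < p\<close> and \<open>a\<close> letters 1
  in total, which is what the \<open>p\<close>-nomial coefficient counts (\<open>card_fib_strings\<close>). This
  coefficient is nonzero exactly for \<open>a \<le> (n + 1 - a) (p - 1)\<close>, that is, up to the claimed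
  degree (\<open>pnomial_diff_eq_0_iff\<close>); the coefficient of the cube polynomial at the largest such
  \<open>a\<close> is this \<open>p\<close>-nomial coefficient itself.
\<close>

section \<open>Counting Fibonacci strings by weight\<close>

text \<open>
  A run of 1s cannot cross a 0, so a 0 cuts the avoidance of \<open>1\<^sup>p\<close> into two independent
  conditions.
\<close>

lemma fib_string_append_False:
  assumes "p \<ge> 1"
  shows "fib_string p (xs @ False # ys) \<longleftrightarrow> fib_string p xs \<and> fib_string p ys"
proof -
  have pre: "prefix us (False # ys) \<longleftrightarrow> us = []" if "set us \<subseteq> {True}" for us
    using that by (cases us) auto
  have ne: "\<not> prefix (replicate p True) (False # ys)"
    using assms by (subst pre) auto
  have split: "suffix (replicate p True) xs"
    if "replicate p True = us @ vs" "suffix us xs" "prefix vs (False # ys)" for us vs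
  proof -
    have "set vs \<subseteq> {True}"
      using arg_cong[OF that(1), of set] by (auto simp: set_replicate_conv_if split: if_splits)
    then show ?thesis using pre that by simp
  qed
  have "sublist (replicate p True) (xs @ False # ys)
      \<longleftrightarrow> sublist (replicate p True) xs \<or> sublist (replicate p True) ys"
    using ne by (auto simp: sublist_append sublist_Cons_right dest!: split
        dest: suffix_imp_sublist)
  then show ?thesis by (simp add: fib_string_def)
qed

lemma fib_string_replicate: "fib_string p (replicate i True) \<longleftrightarrow> i < p"
proof -
  have "sublist (replicate p True) (replicate i True)" if "p \<le> i"
    using that by (metis le_add_diff_inverse replicate_add sublist_append_rightI)
  moreover have "p \<le> i" if "sublist (replicate p True) (replicate i True)"
    using sublist_length_le[OF that] by simp
  ultimately show ?thesis by (auto simp: fib_string_def not_le[symmetric])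
qed

text \<open>
  The concatenations of \<open>b\<close> blocks \<open>1\<^sup>i0\<close> with \<open>i < p\<close> that contain \<open>a\<close> letters 1 altogether.
  They are described without the blocks, so that the link to Fibonacci strings is immediate;
  the splitting into blocks is the recursion over \<open>b\<close> below.
\<close>

definition block_words :: "nat \<Rightarrow> nat \<Rightarrow> nat \<Rightarrow> bool list set" where
  "block_words p b a = {u. (u = [] \<or> \<not> last u) \<and> fib_string p u
     \<and> count_list u False = b \<and> count_list u True = a}"

lemma count_True_False: "count_list w True + count_list w False = length w"
  by (induction w) auto

lemma finite_block_words: "finite (block_words p b a)"
proof (rule finite_subset)
  show "block_words p b a \<subseteq> {u. set u \<subseteq> UNIV \<and> length u = a + b}"
    using count_True_False by (fastforce simp: block_words_def)
qed (rule finite_lists_length_eq, simp)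

lemma count_list_replicate: "count_list (replicate i x) y = (if x = y then i else 0)"
  by (induction i) auto

text \<open>
  The first 0 of a word ends its first block.
\<close>

lemma block_words_Suc:
  assumes "p \<ge> 1"
  shows "block_words p (Suc b) a
    = (\<Union>i \<in> {i. i < p \<and> i \<le> a}. (\<lambda>u. replicate i True @ False # u) ` block_words p b (a - i))"
proof (intro equalityI subsetI)
  fix u assume u: "u \<in> block_words p (Suc b) a"
  then have "False \<in> set u"
    by (cases "False \<in> set u") (simp_all add: block_words_def)
  then obtain xs ys where xy: "u = xs @ False # ys" "False \<notin> set xs"
    by (meson split_list_first)
  have xs: "xs = replicate (length xs) True"
    using xy(2) by (metis (full_types) replicate_eqI)
  define i where "i = length xs"
  have u_eq: "u = replicate i True @ False # ys"
    using xy xs by (simp add: i_def)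
  then have "fib_string p (replicate i True)" "fib_string p ys"
    using u assms by (auto simp: block_words_def fib_string_append_False)
  then show "u \<in> (\<Union>i \<in> {i. i < p \<and> i \<le> a}. (\<lambda>u. replicate i True @ False # u) ` block_words p b (a - i))"
    using u by (cases "ys = []") (auto simp: u_eq block_words_def fib_string_replicate count_list_replicate
        split: if_splits)
next
  fix u assume "u \<in> (\<Union>i \<in> {i. i < p \<and> i \<le> a}. (\<lambda>u. replicate i True @ False # u) ` block_words p b (a - i))"
  then show "u \<in> block_words p (Suc b) a"
    using assms by (auto simp: block_words_def fib_string_append_False fib_string_replicate
        count_list_replicate split: if_splits)
qed

text \<open>
  Extracting one factor of the power gives the same recursion as removing the first block of
  a word.
\<close>

lemma pnomial_Suc:
  "pnomial p (Suc b) a = (\<Sum>i \<in> {i. i < p \<and> i \<le> a}. pnomial p b (a - i))"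
proof -
  have "pnomial p (Suc b) a
      = (\<Sum>i<p. coeff (monom 1 i * (\<Sum>i<p. monom 1 i :: nat poly) ^ b) a)"
    by (simp add: pnomial_def sum_distrib_right coeff_sum)
  also have "\<dots> = (\<Sum>i<p. if i \<le> a then pnomial p b (a - i) else 0)"
    by (intro sum.cong refl) (simp add: coeff_monom_mult pnomial_def)
  also have "\<dots> = (\<Sum>i \<in> {i. i < p \<and> i \<le> a}. pnomial p b (a - i))"
    by (intro sum.mono_neutral_cong_right) auto
  finally show ?thesis .
qed

lemma pnomial_0: "pnomial p 0 a = (if a = 0 then 1 else 0)"
  by (simp add: pnomial_def)

lemma replicate_True_False_inj:
  assumes "replicate i True @ False # u = replicate j True @ False # v"
  shows "i = j"
proof -
  have "length (takeWhile id (replicate k True @ False # w)) = k" for k and w :: "bool list"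
    by (induction k) auto
  then show ?thesis using assms by metis
qed

lemma card_block_words:
  assumes "p \<ge> 1"
  shows "card (block_words p b a) = pnomial p b a"
proof (induction b arbitrary: a)
  case 0
  have "u \<in> block_words p 0 a \<longleftrightarrow> u = [] \<and> a = 0" for u
    using assms by (cases u rule: rev_cases) (auto simp: block_words_def fib_string_def)
  then have "block_words p 0 a = (if a = 0 then {[]} else {})"
    by auto
  then show ?case by (simp add: pnomial_0)
next
  case (Suc b)
  have "card (block_words p (Suc b) a)
      = (\<Sum>i \<in> {i. i < p \<and> i \<le> a}. card ((\<lambda>u. replicate i True @ False # u) ` block_words p b (a - i)))"
    unfolding block_words_Suc[OF assms]
    by (rule card_UN_disjoint) (auto simp: finite_block_words dest: replicate_True_False_inj)
  also have "\<dots> = (\<Sum>i \<in> {i. i < p \<and> i \<le> a}. pnomial p b (a - i))"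
    by (intro sum.cong refl) (simp add: card_image inj_on_def Suc.IH)
  finally show ?case by (simp add: pnomial_Suc)
qed

text \<open>
  Appending a 0 to a Fibonacci string of length \<open>n\<close> and weight \<open>a\<close> makes it a sequence of
  \<open>n + 1 - a\<close> blocks, one for each 0; the appended 0 closes the last block, which may otherwise
  lack its 0.
\<close>

lemma card_fib_strings:
  assumes "p \<ge> 1" and "a \<le> n + 1"
  shows "card {w. length w = n \<and> fib_string p w \<and> weight w = a} = pnomial p (n + 1 - a) a"
proof -
  have "bij_betw (\<lambda>w. w @ [False]) {w. length w = n \<and> fib_string p w \<and> weight w = a}
      (block_words p (n + 1 - a) a)"
  proof (rule bij_betw_byWitness[where f' = butlast])
    have fib: "fib_string p (w @ [False]) \<longleftrightarrow> fib_string p w" for w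
      using fib_string_append_False[OF assms(1), of w "[]"] assms(1)
      by (simp add: fib_string_def)
    have nonempty: "u \<noteq> []" if "u \<in> block_words p (n + 1 - a) a" for u
      using that assms(2) by (auto simp: block_words_def)
    have snoc: "\<exists>w. u = w @ [False]" if "u \<in> block_words p (n + 1 - a) a" for u
      using that nonempty[OF that]
      by (cases u rule: rev_cases) (auto simp: block_words_def)
    show "(\<lambda>w. w @ [False]) ` {w. length w = n \<and> fib_string p w \<and> weight w = a}
        \<subseteq> block_words p (n + 1 - a) a"
    proof clarify
      fix w assume w: "fib_string p w" "n = length w" "a = weight w"
      then show "w @ [False] \<in> block_words p (length w + 1 - weight w) (weight w)"
        using count_True_False[of w] by (simp add: block_words_def fib weight_def)
    qed
    show "butlast ` block_words p (n + 1 - a) a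
        \<subseteq> {w. length w = n \<and> fib_string p w \<and> weight w = a}"
    proof clarify
      fix u assume u: "u \<in> block_words p (n + 1 - a) a"
      with snoc obtain w where "u = w @ [False]" by blast
      with u assms(2) show "length (butlast u) = n \<and> fib_string p (butlast u) \<and> weight (butlast u) = a"
        using count_True_False[of w] by (auto simp: block_words_def fib weight_def)
    qed
    show "\<forall>u\<in>block_words p (n + 1 - a) a. butlast u @ [False] = u"
      using snoc by (metis butlast_snoc)
  qed simp
  then show ?thesis
    by (simp add: bij_betw_same_card card_block_words[OF assms(1)])
qed

text \<open>
  The \<open>b\<close>-th power of \<open>1 + x + \<dots> + x\<^sup>p\<^sup>-\<^sup>1\<close> has degree \<open>b (p - 1)\<close> and no gaps below it.
\<close>

lemma pnomial_eq_0_iff: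
  assumes "p \<ge> 1"
  shows "pnomial p b a = 0 \<longleftrightarrow> b * (p - 1) < a"
proof (induction b arbitrary: a)
  case 0
  then show ?case by (simp add: pnomial_0)
next
  case (Suc b)
  have "pnomial p (Suc b) a = 0 \<longleftrightarrow> (\<forall>i. i < p \<and> i \<le> a \<longrightarrow> b * (p - 1) < a - i)"
    by (simp add: pnomial_Suc Suc.IH)
  \<comment> \<open>The largest admissible first block leaves the smallest remainder, so it decides.\<close>
  also have "\<dots> \<longleftrightarrow> b * (p - 1) < a - min a (p - 1)"
  proof
    show "b * (p - 1) < a - min a (p - 1)"
      if "\<forall>i. i < p \<and> i \<le> a \<longrightarrow> b * (p - 1) < a - i"
      using that assms by (intro that[rule_format]) auto
    show "\<forall>i. i < p \<and> i \<le> a \<longrightarrow> b * (p - 1) < a - i"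
      if "b * (p - 1) < a - min a (p - 1)"
    proof (intro allI impI)
      fix i assume "i < p \<and> i \<le> a"
      then have "a - min a (p - 1) \<le> a - i" by auto
      with that show "b * (p - 1) < a - i" by simp
    qed
  qed
  also have "\<dots> \<longleftrightarrow> Suc b * (p - 1) < a"
    by auto
  finally show ?case .
qed

text \<open>
  This is where the upper limit of the sums comes from: \<open>a \<le> (m - a) (p - 1)\<close> means
  \<open>a p \<le> m (p - 1)\<close>.
\<close>

lemma pnomial_diff_eq_0_iff:
  assumes "p \<ge> 1" and "a \<le> m"
  shows "pnomial p (m - a) a = 0 \<longleftrightarrow> m * (p - 1) div p < a"
proof -
  obtain q where p: "p = Suc q" using assms(1) by (cases p) auto
  have "(m - a) * q < a \<longleftrightarrow> m * q < a * Suc q"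
    unfolding diff_mult_distrib mult_Suc_right using mult_le_mono1[OF assms(2), of q] by linarith
  then show ?thesis
    using assms(1) by (simp add: pnomial_eq_0_iff p div_less_iff_less_mult)
qed

section \<open>Subcubes of a hypercube\<close>

text \<open>
  A string of length \<open>n\<close> is identified with the set of positions of its 1s. Adjacency becomes
  symmetric difference of size one, and subcubes become intervals for inclusion.
\<close>

definition ones :: "bool list \<Rightarrow> nat set" where
  "ones w = {i. i < length w \<and> w ! i}"

definition string_of :: "nat \<Rightarrow> nat set \<Rightarrow> bool list" where
  "string_of n A = map (\<lambda>i. i \<in> A) [0..<n]"

lemma length_string_of [simp]: "length (string_of n A) = n"
  by (simp add: string_of_def)

lemma ones_string_of: "A \<subseteq> {..<n} \<Longrightarrow> ones (string_of n A) = A"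
  by (auto simp: ones_def string_of_def)

lemma string_of_ones: "length w = n \<Longrightarrow> string_of n (ones w) = w"
  by (auto simp: ones_def string_of_def intro: nth_equalityI)

lemma ones_subset: "ones w \<subseteq> {..<length w}"
  by (auto simp: ones_def)

lemma finite_ones [simp]: "finite (ones w)"
  by (simp add: ones_def)

lemma ones_inject: "length u = length v \<Longrightarrow> ones u = ones v \<Longrightarrow> u = v"
  by (metis string_of_ones)

lemma inj_on_ones: "inj_on ones {w. length w = n}"
  by (rule inj_onI) (auto intro: ones_inject)

lemma weight_eq_card_ones: "weight w = card (ones w)"
  by (simp add: weight_def ones_def count_list_eq_length_filter length_filter_conv_card eq_commute)

lemma zero_string_eq: "zero_string n = string_of n {}"
  by (simp add: zero_string_def string_of_def map_replicate_const)

lemma verts_hypercube [simp]: "verts (hypercube n) = {w. length w = n}"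
  and tail_hypercube [simp]: "tail (hypercube n) = fst"
  and head_hypercube [simp]: "head (hypercube n) = snd"
  by (simp_all add: hypercube_def with_proj_def)

lemma arc_hypercube_iff:
  "(u, v) \<in> arcs (hypercube n)
    \<longleftrightarrow> length u = n \<and> length v = n \<and> card (sym_diff (ones u) (ones v)) = 1"
proof -
  have "(u, v) \<in> arcs (hypercube n) \<longleftrightarrow> length u = n \<and> length v = n
      \<and> card {i. i < n \<and> u ! i \<noteq> v ! i} = 1"
    unfolding hypercube_def with_proj_simps pair_pre_digraph.select_convs by blast
  moreover have "{i. i < n \<and> u ! i \<noteq> v ! i} = sym_diff (ones u) (ones v)"
    if "length u = n" "length v = n"
    using that by (auto simp: ones_def)
  ultimately show ?thesis by metis
qed

text \<open>
  Every injective map between hypercubes that preserves adjacency is an embedding along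
  coordinate directions; here for a map that fixes the origin. The images of the unit vectors
  define the map \<open>\<sigma>\<close> of directions. If a vertex \<open>A\<close> lies opposite to \<open>C\<close> in the square spanned at \<open>C\<close>
  by two directions, then its image is forced: the images of the other two corners have only
  two common neighbours, and injectivity rules out the image of \<open>C\<close>.
\<close>

lemma hypercube_embedding_normalized:
  fixes g :: "'a set \<Rightarrow> 'b set"
  assumes "finite K" and inj: "inj_on g (Pow K)" and empty: "g {} = {}"
    and step: "\<And>A i. A \<subseteq> K \<Longrightarrow> i \<in> K \<Longrightarrow> i \<notin> A \<Longrightarrow> \<exists>j. g (insert i A) = sym_diff (g A) {j}"
  obtains \<sigma> where "inj_on \<sigma> K" and "\<And>A. A \<subseteq> K \<Longrightarrow> g A = \<sigma> ` A"
proof -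
  have "\<forall>i\<in>K. \<exists>j. g {i} = {j}"
    using step[of "{}"] by (auto simp: empty)
  then obtain \<sigma> where \<sigma>: "g {i} = {\<sigma> i}" if "i \<in> K" for i
    by metis
  have inj_\<sigma>: "inj_on \<sigma> K"
  proof (rule inj_onI)
    fix i j assume "i \<in> K" "j \<in> K" "\<sigma> i = \<sigma> j"
    then have "g {i} = g {j}" by (simp add: \<sigma>)
    then show "i = j" using inj_onD[OF inj] \<open>i \<in> K\<close> \<open>j \<in> K\<close> by blast
  qed
  have "g A = \<sigma> ` A" if "A \<subseteq> K" for A
    using finite_subset[OF that \<open>finite K\<close>] that
  proof (induction A rule: finite_psubset_induct)
    case (psubset A)
    consider "A = {}" | i where "A = {i}" | i k C where "A = insert i (insert k C)" "i \<noteq> k" "i \<notin> C" "k \<notin> C"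
      by (metis insert_absorb2 insertCI mk_disjoint_insert all_not_in_conv)
    then show ?case
    proof cases
      case (3 i k C)
      have less: "C \<subset> A" "insert i C \<subset> A" "insert k C \<subset> A"
        using 3 by auto
      have gC: "g C = \<sigma> ` C"
        using psubset.IH[OF less(1)] psubset.prems 3 by auto
      have gi: "g (insert i C) = insert (\<sigma> i) (\<sigma> ` C)"
        using psubset.IH[OF less(2)] psubset.prems 3 by auto
      have gk: "g (insert k C) = insert (\<sigma> k) (\<sigma> ` C)"
        using psubset.IH[OF less(3)] psubset.prems 3 by auto
      have new: "\<sigma> i \<noteq> \<sigma> k" "\<sigma> i \<notin> \<sigma> ` C" "\<sigma> k \<notin> \<sigma> ` C"
        using psubset.prems 3 inj_\<sigma> by (auto dest: inj_onD)
      obtain j where j: "g A = sym_diff (insert (\<sigma> i) (\<sigma> ` C)) {j}"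
        using step[of "insert i C" k] psubset.prems 3 gi by (auto simp: insert_commute)
      obtain j' where j': "g A = sym_diff (insert (\<sigma> k) (\<sigma> ` C)) {j'}"
        using step[of "insert k C" i] psubset.prems 3 gk by auto
      \<comment> \<open>The two common neighbours are the image of \<open>C\<close>, excluded here, and the desired set.\<close>
      have "g A \<noteq> \<sigma> ` C"
        using inj_onD[OF inj, of A C] psubset.prems 3 gC by auto
      then have "g A = insert (\<sigma> i) (insert (\<sigma> k) (\<sigma> ` C))"
      proof (cases "j = \<sigma> i")
        case True
        with j new(2) have "g A = \<sigma> ` C" by auto
        with \<open>g A \<noteq> \<sigma> ` C\<close> show ?thesis by simp
      next
        case False
        with j have "\<sigma> i \<in> g A" by auto
        with j' new have "j' = \<sigma> i" by auto
        with j' new show ?thesis by auto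
      qed
      then show ?thesis using 3 by simp
    qed (use psubset.prems \<sigma> empty in auto)
  qed
  then show thesis using that inj_\<sigma> by blast
qed

lemma sym_diff_cancel: "sym_diff S (sym_diff S X) = X"
  by blast

text \<open>
  The general case follows by translating the image of the origin to the origin.
\<close>

lemma hypercube_embedding:
  fixes f :: "'a set \<Rightarrow> 'b set"
  assumes "finite K" and inj: "inj_on f (Pow K)"
    and step: "\<And>A i. A \<subseteq> K \<Longrightarrow> i \<in> K \<Longrightarrow> i \<notin> A \<Longrightarrow> \<exists>j. f (insert i A) = sym_diff (f A) {j}"
  obtains \<sigma> where "inj_on \<sigma> K" and "\<And>A. A \<subseteq> K \<Longrightarrow> f A = sym_diff (f {}) (\<sigma> ` A)"
proof (rule hypercube_embedding_normalized[of K "\<lambda>A. sym_diff (f {}) (f A)"])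
  show "finite K" by fact
  show "inj_on (\<lambda>A. sym_diff (f {}) (f A)) (Pow K)"
  proof (rule inj_onI)
    fix A B assume AB: "A \<in> Pow K" "B \<in> Pow K" "sym_diff (f {}) (f A) = sym_diff (f {}) (f B)"
    from arg_cong[OF AB(3), of "sym_diff (f {})"] have "f A = f B"
      by (simp only: sym_diff_cancel)
    then show "A = B" by (rule inj_onD[OF inj _ AB(1,2)])
  qed
  show "sym_diff (f {}) (f {}) = {}" by simp
next
  fix A i assume A: "A \<subseteq> K" "i \<in> K" "i \<notin> A"
  obtain j where "f (insert i A) = sym_diff (f A) {j}"
    using step[OF A] by blast
  then have "sym_diff (f {}) (f (insert i A)) = sym_diff (sym_diff (f {}) (f A)) {j}"
    by blast
  then show "\<exists>j. sym_diff (f {}) (f (insert i A)) = sym_diff (sym_diff (f {}) (f A)) {j}" ..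
next
  fix \<sigma> assume inj_\<sigma>: "inj_on \<sigma> K"
    and \<sigma>: "\<And>A. A \<subseteq> K \<Longrightarrow> sym_diff (f {}) (f A) = \<sigma> ` A"
  have f_eq: "f A = sym_diff (f {}) (\<sigma> ` A)" if "A \<subseteq> K" for A
    unfolding \<sigma>[OF that, symmetric] by (rule sym_diff_cancel[symmetric])
  show thesis by (rule that[OF inj_\<sigma> f_eq])
qed

definition cube_between :: "nat \<Rightarrow> nat set \<Rightarrow> nat set \<Rightarrow> bool list set" where
  "cube_between n B T = {w. length w = n \<and> B \<subseteq> ones w \<and> ones w \<subseteq> T}"

lemma ones_image_cube_between:
  assumes "T \<subseteq> {..<n}"
  shows "ones ` cube_between n B T = {X. B \<subseteq> X \<and> X \<subseteq> T}"
proof (intro equalityI subsetI)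
  fix X assume X: "X \<in> {X. B \<subseteq> X \<and> X \<subseteq> T}"
  then have "ones (string_of n X) = X"
    using assms by (intro ones_string_of) auto
  then show "X \<in> ones ` cube_between n B T"
    using X by (intro image_eqI[of _ _ "string_of n X"]) (auto simp: cube_between_def)
qed (auto simp: cube_between_def)

lemma sym_diff_interval:
  "(\<lambda>J. sym_diff S J) ` Pow I = {X. S - I \<subseteq> X \<and> X \<subseteq> S \<union> I}"
proof (intro equalityI subsetI)
  fix X assume "X \<in> {X. S - I \<subseteq> X \<and> X \<subseteq> S \<union> I}"
  then show "X \<in> (\<lambda>J. sym_diff S J) ` Pow I"
    by (intro image_eqI[of _ _ "sym_diff S X"]) auto
qed auto

text \<open>
  By the embedding lemma, the image of a copy of the \<open>k\<close>-cube consists of all translates of one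
  vertex \<open>S\<close> by subsets of a set \<open>I\<close> of \<open>k\<close> coordinates, which is the interval from \<open>S - I\<close> to
  \<open>S \<union> I\<close>.
\<close>

lemma verts_of_hypercube_copy:
  assumes "subgraph H (hypercube n)" and "digraph_iso H (hypercube k)"
  obtains B T where "B \<subseteq> T" "T \<subseteq> {..<n}" "card (T - B) = k" "verts H = cube_between n B T"
proof -
  have V: "verts H \<subseteq> {w. length w = n}" and A: "arcs H \<subseteq> arcs (hypercube n)"
    and proj: "tail H = fst" "head H = snd" and wf: "wf_digraph H"
    using assms(1) by (auto simp: subgraph_def compatible_def)
  obtain h where h: "pre_digraph.digraph_isomorphism H h" and Q: "hypercube k = app_iso h H"
    using assms(2) by (auto simp: digraph_iso_def)
  have inj_h: "inj_on (iso_verts h) (verts H)"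
    using h by (simp add: pre_digraph.digraph_isomorphism_def)
  have img_h: "iso_verts h ` verts H = {w. length w = k}"
    using verts_app_iso[of h H] by (simp flip: Q)
  have arcs_h: "iso_arcs h ` arcs H = arcs (hypercube k)"
    using arcs_app_iso[of h H] by (simp flip: Q)
  have iso_proj: "iso_tail h = fst" "iso_head h = snd"
    using tail_app_iso[of h H] head_app_iso[of h H] by (simp_all flip: Q)
  \<comment> \<open>The embedding lemma needs a map out of the \<open>k\<close>-cube, so the isomorphism is inverted.\<close>
  define \<phi> where "\<phi> = the_inv_into (verts H) (iso_verts h)"
  have bij_\<phi>: "bij_betw \<phi> {w. length w = k} (verts H)"
    unfolding \<phi>_def img_h[symmetric] by (intro bij_betw_the_inv_into inj_on_imp_bij_betw inj_h)
  have \<phi>_arc: "(\<phi> u, \<phi> v) \<in> arcs (hypercube n)" if "(u, v) \<in> arcs (hypercube k)" for u v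
  proof -
    have "(u, v) \<in> iso_arcs h ` arcs H"
      using that by (simp only: arcs_h)
    then obtain a where "(u, v) = iso_arcs h a" "a \<in> arcs H"
      by (rule imageE)
    then have a: "a \<in> arcs H" "iso_arcs h a = (u, v)"
      by simp_all
    have "fst a \<in> verts H" "snd a \<in> verts H"
      using wf_digraph.wellformed[OF wf a(1)] proj by auto
    moreover have "iso_verts h (fst a) = u" "iso_verts h (snd a) = v"
      using h a proj iso_proj by (auto simp: pre_digraph.digraph_isomorphism_def)
    ultimately have "\<phi> u = fst a" "\<phi> v = snd a"
      unfolding \<phi>_def using inj_h by (auto simp: the_inv_into_f_f)
    then show ?thesis using a(1) A by auto
  qed
  define f where "f X = ones (\<phi> (string_of k X))" for X
  have len_\<phi>: "\<phi> w \<in> verts H" "length (\<phi> w) = n" if "length w = k" for w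
    using that bij_\<phi> V by (auto simp: bij_betw_def)
  have inj_f: "inj_on f (Pow {..<k})"
  proof (rule inj_onI)
    fix X Y assume XY: "X \<in> Pow {..<k}" "Y \<in> Pow {..<k}" "f X = f Y"
    then have "\<phi> (string_of k X) = \<phi> (string_of k Y)"
      unfolding f_def by (intro ones_inject) (auto simp: len_\<phi>)
    then have "string_of k X = string_of k Y"
      using bij_\<phi> by (auto simp: bij_betw_def dest: inj_onD)
    then show "X = Y"
      using XY ones_string_of by (metis PowD)
  qed
  have step_f: "\<exists>j. f (insert i X) = sym_diff (f X) {j}" if X: "X \<subseteq> {..<k}" "i \<in> {..<k}" "i \<notin> X" for X i
  proof -
    have "sym_diff X (insert i X) = {i}" using X by auto
    then have "(string_of k X, string_of k (insert i X)) \<in> arcs (hypercube k)"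
      using X by (simp add: arc_hypercube_iff ones_string_of)
    from \<phi>_arc[OF this] have "card (sym_diff (f X) (f (insert i X))) = 1"
      by (simp add: arc_hypercube_iff f_def)
    then obtain j where "sym_diff (f X) (f (insert i X)) = {j}"
      by (rule card_1_singletonE)
    then have "f (insert i X) = sym_diff (f X) {j}" by blast
    then show ?thesis ..
  qed
  obtain \<sigma> where inj_\<sigma>: "inj_on \<sigma> {..<k}"
    and f_eq: "\<And>X. X \<subseteq> {..<k} \<Longrightarrow> f X = sym_diff (f {}) (\<sigma> ` X)"
    using hypercube_embedding[OF finite_lessThan inj_f step_f] by blast
  define I B T where "I = \<sigma> ` {..<k}" and "B = f {} - I" and "T = f {} \<union> I"
  have "ones ` verts H = f ` Pow {..<k}"
  proof -
    have "string_of k ` Pow {..<k} = {w. length w = k}"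
    proof (intro equalityI subsetI)
      fix w :: "bool list" assume "w \<in> {w. length w = k}"
      then show "w \<in> string_of k ` Pow {..<k}"
        using string_of_ones[of w k] ones_subset[of w]
        by (intro image_eqI[of _ _ "ones w"]) auto
    qed auto
    then have "verts H = \<phi> ` string_of k ` Pow {..<k}"
      using bij_\<phi> by (simp add: bij_betw_def)
    then show ?thesis
      by (simp add: f_def image_image)
  qed
  also have "\<dots> = (\<lambda>X. sym_diff (f {}) (\<sigma> ` X)) ` Pow {..<k}"
    by (intro image_cong refl f_eq) auto
  also have "\<dots> = (\<lambda>J. sym_diff (f {}) J) ` (image \<sigma> ` Pow {..<k})"
    by (simp add: image_image)
  also have "\<dots> = {X. B \<subseteq> X \<and> X \<subseteq> T}"
    unfolding image_Pow_surj[OF refl] I_def[symmetric] B_def T_def by (rule sym_diff_interval)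
  finally have ones_H: "ones ` verts H = {X. B \<subseteq> X \<and> X \<subseteq> T}" .
  have T_sub: "T \<subseteq> {..<n}"
  proof -
    have "T \<in> ones ` verts H" unfolding ones_H by (auto simp: B_def T_def)
    then show ?thesis using ones_subset V by fastforce
  qed
  have "verts H = cube_between n B T"
  proof -
    have "ones ` verts H = ones ` cube_between n B T"
      by (simp add: ones_H ones_image_cube_between[OF T_sub])
    then show ?thesis
      using inj_on_image_eq_iff[OF inj_on_ones[of n], of "verts H" "cube_between n B T"] V
      by (simp add: cube_between_def subset_iff)
  qed
  moreover have "T - B = I" "B \<subseteq> T" by (auto simp: B_def T_def)
  moreover have "card I = k" by (simp add: I_def card_image inj_\<sigma>)
  ultimately show thesis using that T_sub by simp
qed

text \<open>
  An isomorphism of digraphs also carries maps on arcs and new incidence functions. If arcs are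
  pairs of vertices, all of these are forced by the vertex map.
\<close>

lemma digraph_iso_projI:
  fixes G :: "('a, 'a \<times> 'a) pre_digraph" and H :: "('b, 'b \<times> 'b) pre_digraph"
  assumes "wf_digraph G" "tail G = fst" "head G = snd"
    and "wf_digraph H" "tail H = fst" "head H = snd"
    and bij: "bij_betw g (verts G) (verts H)"
    and arcs: "\<And>u v. u \<in> verts G \<Longrightarrow> v \<in> verts G \<Longrightarrow> (u, v) \<in> arcs G \<longleftrightarrow> (g u, g v) \<in> arcs H"
  shows "digraph_iso G H"
proof -
  define h where "h = \<lparr>iso_verts = g, iso_arcs = map_prod g g, iso_head = snd, iso_tail = fst\<rparr>"
  have arc_G: "u \<in> verts G \<and> v \<in> verts G" if "(u, v) \<in> arcs G" for u v
    using wf_digraph.wellformed[OF assms(1) that] assms by simp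
  have arc_H: "u \<in> verts H \<and> v \<in> verts H" if "(u, v) \<in> arcs H" for u v
    using wf_digraph.wellformed[OF assms(4) that] assms by simp
  have inj: "inj_on g (verts G)" and surj: "g ` verts G = verts H"
    using bij by (auto simp: bij_betw_def)
  have "inj_on (map_prod g g) (arcs G)"
    by (rule inj_on_subset[OF map_prod_inj_on[OF inj inj]]) (use arc_G in auto)
  then have "pre_digraph.digraph_isomorphism G h"
    using assms inj by (simp add: pre_digraph.digraph_isomorphism_def h_def)
  moreover have "map_prod g g ` arcs G = arcs H"
  proof (intro equalityI subsetI)
    fix e assume e: "e \<in> arcs H"
    obtain x y where xy: "e = (x, y)" by fastforce
    with e obtain u v where uv: "u \<in> verts G" "v \<in> verts G" "x = g u" "y = g v"
      using arc_H surj by (metis imageE)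
    with e xy show "e \<in> map_prod g g ` arcs G"
      using arcs by (intro image_eqI[of _ _ "(u, v)"]) auto
  qed (use arcs arc_G in auto)
  then have "H = app_iso h G"
    using assms surj by (intro pre_digraph.equality) (auto simp: h_def)
  ultimately show ?thesis by (auto simp: digraph_iso_def)
qed

lemma verts_induce [simp]: "verts (G \<restriction> V) = V"
  and tail_induce [simp]: "tail (G \<restriction> V) = tail G"
  and head_induce [simp]: "head (G \<restriction> V) = head G"
  by (simp_all add: induce_subgraph_def)

lemma arcs_induce: "arcs (G \<restriction> V) = {e \<in> arcs G. tail G e \<in> V \<and> head G e \<in> V}"
  by (simp add: induce_subgraph_def)

lemma wf_induce_hypercube: "wf_digraph (hypercube n \<restriction> V)"
proof -
  interpret graph "hypercube n" by (rule graph_hypercube)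
  show ?thesis by (rule wellformed_induce_subgraph)
qed

text \<open>
  Conversely every interval is a cube: number the free coordinates and keep the bottom fixed.
\<close>

lemma hypercube_iso_cube_between:
  assumes "B \<subseteq> T" "T \<subseteq> {..<n}"
  shows "digraph_iso (hypercube (card (T - B))) (hypercube n \<restriction> cube_between n B T)"
proof -
  define k where "k = card (T - B)"
  have "finite (T - B)" using assms(2) finite_subset by blast
  then obtain \<sigma> where \<sigma>: "bij_betw \<sigma> {..<k} (T - B)"
    using ex_bij_betw_nat_finite[of "T - B"] by (auto simp: k_def atLeast0LessThan)
  then have inj: "inj_on \<sigma> {..<k}" and img: "\<sigma> ` {..<k} = T - B"
    by (auto simp: bij_betw_def)
  define g where "g w = string_of n (B \<union> \<sigma> ` ones w)" for w
  have ones_g: "ones (g w) = B \<union> \<sigma> ` ones w" and g_T: "\<sigma> ` ones w \<subseteq> T - B" if "length w = k" for w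
  proof -
    show "\<sigma> ` ones w \<subseteq> T - B" using ones_subset[of w] that img by auto
    then show "ones (g w) = B \<union> \<sigma> ` ones w"
      unfolding g_def using assms by (intro ones_string_of) auto
  qed
  have wf: "wf_digraph (hypercube k)"
    using graph_hypercube by (metis graph.axioms(1) digraph.axioms(1) fin_digraph.axioms(1))
  show ?thesis
    unfolding k_def[symmetric]
  proof (rule digraph_iso_projI[where g = g, OF wf _ _ wf_induce_hypercube])
    have "inj_on g {w. length w = k}"
    proof (rule inj_onI)
      fix u v assume uv: "u \<in> {w. length w = k}" "v \<in> {w. length w = k}" "g u = g v"
      have "\<sigma> ` ones w = ones (g w) - B" if "length w = k" for w
        unfolding ones_g[OF that] using g_T[OF that] by blast
      then have "\<sigma> ` ones u = \<sigma> ` ones v"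
        using uv by simp
      then have "ones u = ones v"
        using inj_on_image_eq_iff[OF inj, of "ones u" "ones v"] ones_subset[of u] ones_subset[of v] uv by simp
      then show "u = v" using uv by (intro ones_inject) auto
    qed
    moreover have "g ` {w. length w = k} = cube_between n B T"
    proof (intro equalityI subsetI)
      fix w assume w: "w \<in> cube_between n B T"
      have "ones w - B \<subseteq> \<sigma> ` {..<k}" using w img by (auto simp: cube_between_def)
      then obtain J where J: "J \<subseteq> {..<k}" "ones w - B = \<sigma> ` J"
        by (meson subset_imageE)
      then have "B \<union> \<sigma> ` ones (string_of k J) = ones w"
        using w by (auto simp: ones_string_of cube_between_def)
      then have "w = g (string_of k J)"
        using w string_of_ones[of w n] by (simp add: g_def cube_between_def)
      then show "w \<in> g ` {w. length w = k}" by simp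
    next
      fix w assume "w \<in> g ` {w. length w = k}"
      then obtain u where u: "length u = k" "w = g u" by auto
      moreover have "length (g u) = n" by (simp add: g_def)
      ultimately show "w \<in> cube_between n B T"
        using ones_g[of u] g_T[of u] assms(1) by (auto simp: cube_between_def)
    qed
    ultimately show bij: "bij_betw g (verts (hypercube k)) (verts (hypercube n \<restriction> cube_between n B T))"
      by (simp add: bij_betw_def)
    fix u v assume uv: "u \<in> verts (hypercube k)" "v \<in> verts (hypercube k)"
    have "sym_diff (ones (g u)) (ones (g v)) = \<sigma> ` sym_diff (ones u) (ones v)"
    proof -
      have sub: "ones u \<subseteq> {..<k}" "ones v \<subseteq> {..<k}" using uv ones_subset[of u] ones_subset[of v] by auto
      have "sym_diff (ones (g u)) (ones (g v)) = sym_diff (\<sigma> ` ones u) (\<sigma> ` ones v)"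
        using uv ones_g[of u] ones_g[of v] g_T[of u] g_T[of v] by auto
      also have "\<dots> = \<sigma> ` sym_diff (ones u) (ones v)"
        using sub by (simp add: image_Un inj_on_image_set_diff[OF inj] Diff_subset_conv le_supI2)
      finally show ?thesis .
    qed
    moreover have "inj_on \<sigma> (sym_diff (ones u) (ones v))"
      by (rule inj_on_subset[OF inj]) (use uv ones_subset[of u] ones_subset[of v] in auto)
    ultimately have "card (sym_diff (ones (g u)) (ones (g v))) = card (sym_diff (ones u) (ones v))"
      by (simp add: card_image)
    moreover have "length (g u) = n" "length (g v) = n" by (simp_all add: g_def)
    moreover have "g u \<in> cube_between n B T" "g v \<in> cube_between n B T"
      using bij uv by (auto simp: bij_betw_def)
    ultimately show "(u, v) \<in> arcs (hypercube k)
        \<longleftrightarrow> (g u, g v) \<in> arcs (hypercube n \<restriction> cube_between n B T)"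
      using uv by (simp add: arcs_induce arc_hypercube_iff)
  qed simp_all
qed

section \<open>Induced subcubes of daisy cubes\<close>

text \<open>
  Daisy cubes are the induced subgraphs of hypercubes on down-closed vertex sets. All that the
  cube polynomials use of Fibonacci strings is that turning 1s into 0s keeps them Fibonacci.
\<close>

locale daisy_cube =
  fixes n :: nat and V :: "bool list set"
  assumes length_V: "w \<in> V \<Longrightarrow> length w = n"
    and down_closed: "w \<in> V \<Longrightarrow> length u = n \<Longrightarrow> ones u \<subseteq> ones w \<Longrightarrow> u \<in> V"
begin

abbreviation G :: string_graph where
  "G \<equiv> hypercube n \<restriction> V"

lemma finite_V: "finite V"
proof (rule finite_subset)
  show "V \<subseteq> {w. set w \<subseteq> UNIV \<and> length w = n}"
    using length_V by auto
qed (rule finite_lists_length_eq, simp)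

lemma inj_on_ones_V: "inj_on ones V"
  by (rule inj_on_subset[OF inj_on_ones[of n]]) (use length_V in auto)

lemma weight_le: "w \<in> V \<Longrightarrow> weight w \<le> n"
  using card_mono[OF finite_lessThan ones_subset[of w]] length_V[of w]
  by (simp add: weight_eq_card_ones)

lemma weight_arc_le:
  assumes "(u, v) \<in> arcs G"
  shows "weight v \<le> weight u + 1"
proof -
  have "card (ones v) \<le> card (ones u \<union> sym_diff (ones u) (ones v))"
    by (rule card_mono) auto
  also have "\<dots> \<le> card (ones u) + card (sym_diff (ones u) (ones v))"
    by (rule card_Un_le)
  also have "card (sym_diff (ones u) (ones v)) = 1"
    using assms by (simp add: arcs_induce arc_hypercube_iff)
  finally show ?thesis by (simp add: weight_eq_card_ones)
qed

lemma weight_le_walk_length: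
  assumes "pre_digraph.awalk G u es v"
  shows "weight v \<le> weight u + length es"
proof -
  have "set es \<subseteq> arcs G" "pre_digraph.cas G u es v"
    using assms by (auto simp: pre_digraph.awalk_def)
  then show ?thesis
  proof (induction es arbitrary: u)
    case Nil
    then show ?case by (simp add: pre_digraph.cas.simps)
  next
    case (Cons e es)
    then have "weight v \<le> weight (snd e) + length es" "fst e = u"
      by (simp_all add: pre_digraph.cas.simps)
    moreover have "weight (snd e) \<le> weight (fst e) + 1"
      using Cons.prems by (intro weight_arc_le) simp
    ultimately show ?case by simp
  qed
qed

lemma walk_from_zero_string:
  assumes "w \<in> V"
  shows "\<exists>es. pre_digraph.awalk G (zero_string n) es w \<and> length es = weight w"
  using assms
proof (induction "weight w" arbitrary: w)
  case 0
  then have "w = zero_string n"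
    using string_of_ones[of w n] length_V[of w] by (simp add: weight_eq_card_ones zero_string_eq)
  then show ?case
    using 0 by (intro exI[of _ "[]"]) (simp add: pre_digraph.awalk_def pre_digraph.cas.simps)
next
  case (Suc m)
  then obtain i where i: "i \<in> ones w"
    by (metis weight_eq_card_ones card.empty all_not_in_conv nat.distinct(1))
  define u where "u = string_of n (ones w - {i})"
  have len: "length w = n" "length u = n" using Suc.prems length_V by (auto simp: u_def)
  have ones_u: "ones u = ones w - {i}"
    unfolding u_def using ones_subset[of w] len by (intro ones_string_of) auto
  have "u \<in> V" using down_closed[OF Suc.prems len(2)] ones_u by auto
  moreover have "weight u = m"
    using Suc.hyps(2) i by (simp add: weight_eq_card_ones ones_u)
  ultimately obtain es where es: "pre_digraph.awalk G (zero_string n) es u" "length es = m"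
    using Suc.hyps(1) by blast
  have "sym_diff (ones u) (ones w) = {i}" using i ones_u by auto
  then have arc: "(u, w) \<in> arcs G"
    using \<open>u \<in> V\<close> Suc.prems len by (simp add: arcs_induce arc_hypercube_iff)
  interpret wf_digraph G by (rule wf_induce_hypercube)
  have "awalk u [(u, w)] w"
    using arc \<open>u \<in> V\<close> by (simp add: awalk_def)
  then have "awalk (zero_string n) (es @ [(u, w)]) w"
    using es(1) by (rule awalk_appendI[rotated])
  then show ?case
    using es(2) Suc.hyps(2) by (intro exI[of _ "es @ [(u, w)]"]) simp
qed

text \<open>
  An arc changes the weight by at most one, and within a down-closed set the 1s of a vertex can
  be removed one at a time; so the distance from \<open>0\<^sup>n\<close> is the weight, as in the whole hypercube.
\<close>

lemma graph_dist_zero_string: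
  assumes "w \<in> V"
  shows "graph_dist G (zero_string n) w = ereal (real (weight w))"
proof -
  interpret wf_digraph G by (rule wf_induce_hypercube)
  have cost: "awalk_cost (\<lambda>_. 1) es = real (length es)" for es :: "(bool list \<times> bool list) list"
    by (induction es) auto
  have zero: "weight (zero_string n) = 0"
    by (simp add: weight_eq_card_ones zero_string_eq ones_string_of)
  obtain es where es: "awalk (zero_string n) es w" "length es = weight w"
    using walk_from_zero_string[OF assms] by blast
  show ?thesis
    unfolding graph_dist_def \<mu>_def
  proof (rule antisym)
    show "(INF es\<in>{es. awalk (zero_string n) es w}. ereal (awalk_cost (\<lambda>_. 1) es)) \<le> ereal (real (weight w))"
      using es by (intro INF_lower2[of es]) (auto simp: cost)
    show "ereal (real (weight w)) \<le> (INF es\<in>{es. awalk (zero_string n) es w}. ereal (awalk_cost (\<lambda>_. 1) es))"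
      using weight_le_walk_length[of "zero_string n" _ w] by (intro INF_greatest) (auto simp: cost zero)
  qed
qed

lemma bottom_vertex_cube_between:
  assumes "verts H = cube_between n B T" "B \<subseteq> T" "T \<subseteq> {..<n}"
  shows "bottom_vertex H = string_of n B"
  unfolding bottom_vertex_def
proof (rule the_equality)
  have B: "ones (string_of n B) = B" using assms by (intro ones_string_of) auto
  have mem: "string_of n B \<in> verts H"
    using assms by (simp add: cube_between_def B)
  have min: "weight (string_of n B) \<le> weight w" if "w \<in> verts H" for w
    using that assms by (auto simp: weight_eq_card_ones B cube_between_def intro: card_mono)
  show "is_arg_min weight (\<lambda>u. u \<in> verts H) (string_of n B)"
    using mem min by (auto simp: is_arg_min_def not_less)
  fix w assume "is_arg_min weight (\<lambda>u. u \<in> verts H) w"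
  then have w: "w \<in> verts H" "weight w \<le> weight (string_of n B)"
    using mem by (auto simp: is_arg_min_def not_less)
  then have "B = ones w"
    using assms(1) by (intro card_seteq) (auto simp: weight_eq_card_ones B cube_between_def)
  then show "w = string_of n B"
    using w(1) assms(1) string_of_ones[of w n] by (simp add: cube_between_def)
qed

text \<open>
  Bottom and top of the \<open>k\<close>-dimensional intervals that lie in \<open>V\<close>; since \<open>V\<close> is down-closed,
  this condition concerns the top only.
\<close>

definition intervals :: "nat \<Rightarrow> (nat set \<times> nat set) set" where
  "intervals k = {(B, T). T \<in> ones ` V \<and> B \<subseteq> T \<and> card (T - B) = k}"

lemma ones_V_subset: "T \<in> ones ` V \<Longrightarrow> T \<subseteq> {..<n}"
  using ones_subset length_V by fastforce

lemma cube_between_subset_iff: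
  assumes "B \<subseteq> T" "T \<subseteq> {..<n}"
  shows "cube_between n B T \<subseteq> V \<longleftrightarrow> T \<in> ones ` V"
proof
  assume "cube_between n B T \<subseteq> V"
  moreover have "T \<in> ones ` cube_between n B T"
    using assms by (simp add: ones_image_cube_between)
  ultimately show "T \<in> ones ` V" by blast
next
  assume "T \<in> ones ` V"
  then show "cube_between n B T \<subseteq> V"
    using down_closed by (auto simp: cube_between_def)
qed

text \<open>
  Counting induced cubes thus becomes counting pairs of sets.
\<close>

lemma bij_betw_intervals_induced_cubes:
  "bij_betw (\<lambda>(B, T). hypercube n \<restriction> cube_between n B T) (intervals k) (induced_cubes G k)"
  unfolding bij_betw_def
proof
  show "inj_on (\<lambda>(B, T). hypercube n \<restriction> cube_between n B T) (intervals k)"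
  proof (rule inj_onI, clarify)
    fix B T B' T'
    assume 1: "(B, T) \<in> intervals k" "(B', T') \<in> intervals k"
      and "hypercube n \<restriction> cube_between n B T = hypercube n \<restriction> cube_between n B' T'"
    then have "verts (hypercube n \<restriction> cube_between n B T) = verts (hypercube n \<restriction> cube_between n B' T')"
      by simp
    then have "ones ` cube_between n B T = ones ` cube_between n B' T'"
      by simp
    moreover have "T \<subseteq> {..<n}" "T' \<subseteq> {..<n}" "B \<subseteq> T" "B' \<subseteq> T'"
      using 1 ones_V_subset by (auto simp: intervals_def)
    ultimately have "{X. B \<subseteq> X \<and> X \<subseteq> T} = {X. B' \<subseteq> X \<and> X \<subseteq> T'}"
      by (simp add: ones_image_cube_between)
    then show "B = B' \<and> T = T'"
      using \<open>B \<subseteq> T\<close> \<open>B' \<subseteq> T'\<close> by (auto simp: set_eq_iff[of "Collect _"])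
  qed
  show "(\<lambda>(B, T). hypercube n \<restriction> cube_between n B T) ` intervals k = induced_cubes G k"
  proof (intro equalityI subsetI)
    fix H assume "H \<in> (\<lambda>(B, T). hypercube n \<restriction> cube_between n B T) ` intervals k"
    then obtain B T where BT: "T \<in> ones ` V" "B \<subseteq> T" "card (T - B) = k"
      and H: "H = hypercube n \<restriction> cube_between n B T"
      by (auto simp: intervals_def)
    have T: "T \<subseteq> {..<n}" using BT ones_V_subset by auto
    have sub: "cube_between n B T \<subseteq> V"
      using BT T cube_between_subset_iff by auto
    have "induced_subgraph H G"
      unfolding induced_subgraph_def subgraph_def compatible_def H
      using sub wf_induce_hypercube by (auto simp: arcs_induce)
    moreover have "digraph_iso H (hypercube k)"
    proof (rule digraph_iso_swap)
      show "wf_digraph (hypercube k)"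
        using graph_hypercube by (metis graph.axioms(1) digraph.axioms(1) fin_digraph.axioms(1))
      show "digraph_iso (hypercube k) H"
        using hypercube_iso_cube_between[OF BT(2) T] BT(3) H by simp
    qed
    ultimately show "H \<in> induced_cubes G k" by (simp add: induced_cubes_def)
  next
    fix H assume "H \<in> induced_cubes G k"
    then have ind: "induced_subgraph H G" and iso: "digraph_iso H (hypercube k)"
      by (auto simp: induced_cubes_def)
    have "subgraph H (hypercube n)"
      using ind graph_hypercube[of n] length_V
      by (auto simp: induced_subgraph_def subgraph_def compatible_def arcs_induce
          graph_def digraph_def fin_digraph_def)
    then obtain B T where BT: "B \<subseteq> T" "T \<subseteq> {..<n}" "card (T - B) = k" "verts H = cube_between n B T"
      using iso by (rule verts_of_hypercube_copy)
    have "cube_between n B T \<subseteq> V"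
      using ind BT by (auto simp: induced_subgraph_def subgraph_def)
    then have "T \<in> ones ` V" using cube_between_subset_iff BT by simp
    moreover have "H = hypercube n \<restriction> cube_between n B T"
    proof (rule pre_digraph.equality)
      show "arcs H = arcs (hypercube n \<restriction> cube_between n B T)"
        using ind BT \<open>cube_between n B T \<subseteq> V\<close> by (auto simp: induced_subgraph_def arcs_induce)
    qed (use ind BT in \<open>auto simp: induced_subgraph_def subgraph_def compatible_def\<close>)
    ultimately show "H \<in> (\<lambda>(B, T). hypercube n \<restriction> cube_between n B T) ` intervals k"
      using BT by (intro image_eqI[of _ _ "(B, T)"]) (auto simp: intervals_def)
  qed
qed

text \<open>
  The interval is determined by its top and the set of its free coordinates within the top.
\<close>

lemma card_lower_ends:
  assumes "finite T"
  shows "card {B. B \<subseteq> T \<and> card (T - B) = k} = card T choose k"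
proof -
  have "bij_betw (\<lambda>B. T - B) {B. B \<subseteq> T \<and> card (T - B) = k} {B. B \<subseteq> T \<and> card B = k}"
    by (rule bij_betw_byWitness[where f' = "\<lambda>B. T - B"]) (auto simp: double_diff)
  then show ?thesis
    using n_subsets[OF assms] by (simp add: bij_betw_same_card)
qed

theorem cube_count_daisy: "cube_count G k = (\<Sum>w\<in>V. weight w choose k)"
proof -
  have "cube_count G k = card (intervals k)"
    unfolding cube_count_def by (rule bij_betw_same_card[OF bij_betw_intervals_induced_cubes, symmetric])
  also have "\<dots> = card (SIGMA T : ones ` V. {B. B \<subseteq> T \<and> card (T - B) = k})"
    by (rule bij_betw_same_card[of prod.swap], rule bij_betw_byWitness[where f' = prod.swap])
       (auto simp: intervals_def)
  also have "\<dots> = (\<Sum>T\<in>ones ` V. card T choose k)"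
    using finite_V by (subst card_SigmaI) (auto simp: card_lower_ends intro!: sum.cong)
  also have "\<dots> = (\<Sum>w\<in>V. weight w choose k)"
    by (subst sum.reindex[OF inj_on_ones_V]) (simp add: weight_eq_card_ones)
  finally show ?thesis .
qed

text \<open>
  A \<open>k\<close>-cube with bottom at distance \<open>d\<close> has a top of weight \<open>d + k\<close>, and each such top in \<open>V\<close>
  serves for every choice of \<open>k\<close> of its 1s as free coordinates.
\<close>

theorem cube_dist_count_daisy:
  "cube_dist_count n G k d = card {w \<in> V. weight w = d + k} * ((d + k) choose k)"
proof -
  let ?W = "{w \<in> V. weight w = d + k}"
  let ?cube = "\<lambda>(B, T). hypercube n \<restriction> cube_between n B T"
  have dist: "graph_dist G (zero_string n) (bottom_vertex (?cube BT)) = ereal (real d)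
      \<longleftrightarrow> card (fst BT) = d" if "BT \<in> intervals k" for BT
  proof -
    obtain B T where BT: "BT = (B, T)" by fastforce
    have T: "T \<in> ones ` V" "B \<subseteq> T" "T \<subseteq> {..<n}"
      using that ones_V_subset by (auto simp: intervals_def BT)
    have ones_B: "ones (string_of n B) = B" using T by (intro ones_string_of) auto
    then have "string_of n B \<in> V" using T down_closed by auto
    then show ?thesis
      using T by (simp add: BT bottom_vertex_cube_between graph_dist_zero_string weight_eq_card_ones ones_B)
  qed
  have "bij_betw ?cube {BT \<in> intervals k. card (fst BT) = d}
      {H \<in> induced_cubes G k. graph_dist G (zero_string n) (bottom_vertex H) = ereal (real d)}"
  proof (rule bij_betw_imageI)
    show "inj_on ?cube {BT \<in> intervals k. card (fst BT) = d}"
      by (rule inj_on_subset[OF bij_betw_imp_inj_on[OF bij_betw_intervals_induced_cubes]]) auto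
    show "?cube ` {BT \<in> intervals k. card (fst BT) = d}
      = {H \<in> induced_cubes G k. graph_dist G (zero_string n) (bottom_vertex H) = ereal (real d)}"
      unfolding bij_betw_imp_surj_on[OF bij_betw_intervals_induced_cubes, symmetric]
      using dist by blast
  qed
  then have "cube_dist_count n G k d = card {BT \<in> intervals k. card (fst BT) = d}"
    unfolding cube_dist_count_def by (rule bij_betw_same_card[symmetric])
  also have "\<dots> = card (SIGMA T : ones ` ?W. {B. B \<subseteq> T \<and> card (T - B) = k})"
  proof -
    have "card T = card B + card (T - B)" if "B \<subseteq> T" "T \<in> ones ` V" for B T
    proof -
      have "finite T" using that(2) by auto
      then show ?thesis using that(1)
        by (metis card_Diff_subset card_mono finite_subset le_add_diff_inverse)
    qed
    then show ?thesis
      by (intro bij_betw_same_card[of prod.swap] bij_betw_byWitness[where f' = prod.swap])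
         (fastforce simp: intervals_def weight_eq_card_ones)+
  qed
  also have "\<dots> = (\<Sum>T\<in>ones ` ?W. card T choose k)"
    using finite_V by (subst card_SigmaI) (auto simp: card_lower_ends intro!: sum.cong)
  also have "\<dots> = (\<Sum>w\<in>?W. weight w choose k)"
    using inj_on_subset[OF inj_on_ones_V, of ?W]
    by (subst sum.reindex) (auto simp: weight_eq_card_ones)
  also have "\<dots> = card ?W * ((d + k) choose k)"
    by simp
  finally show ?thesis .
qed

lemma sum_weights:
  fixes f :: "nat \<Rightarrow> 'a :: comm_semiring_1"
  shows "(\<Sum>w\<in>V. f (weight w)) = (\<Sum>a\<le>n. of_nat (card {w \<in> V. weight w = a}) * f a)"
proof -
  have "(\<Sum>w\<in>V. f (weight w)) = (\<Sum>a\<le>n. \<Sum>w | w \<in> V \<and> weight w = a. f (weight w))"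
    by (rule sum.group[symmetric]) (use finite_V weight_le in auto)
  also have "\<dots> = (\<Sum>a\<le>n. of_nat (card {w \<in> V. weight w = a}) * f a)"
    by (intro sum.cong refl) simp
  finally show ?thesis .
qed

lemma coeff_cube_poly: "coeff (cube_poly G) k = int (cube_count G k)"
proof -
  have "cube_count G k = 0" if "k > n" for k
    unfolding cube_count_daisy
    by (intro sum.neutral ballI binomial_eq_0) (use that weight_le in fastforce)
  then have "{k. monom (int (cube_count G k)) k \<noteq> 0} \<subseteq> {..n}"
    by (auto simp flip: not_less)
  then have "cube_poly G = (\<Sum>k\<le>n. monom (int (cube_count G k)) k)"
    unfolding cube_poly_def by (intro Sum_any.expand_superset) auto
  then show ?thesis
    using \<open>\<And>k. k > n \<Longrightarrow> cube_count G k = 0\<close>[of k] by (auto simp: coeff_sum not_le)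
qed

lemma coeff_one_plus_x_power: "coeff ((1 + monom 1 1) ^ a :: 'a :: comm_semiring_1 poly) k = of_nat (a choose k)"
proof -
  have "(1 + monom 1 1) ^ a = (\<Sum>i\<le>a. of_nat (a choose i) * monom 1 i :: 'a poly)"
    by (subst add.commute, subst binomial_ring) (simp add: monom_power)
  also have "coeff \<dots> k = (\<Sum>i\<le>a. if i = k then of_nat (a choose i) else 0)"
    by (simp add: coeff_sum of_nat_poly mult_monom monom_0[symmetric] eq_commute cong: if_cong)
  also have "\<dots> = of_nat (a choose k)"
    by (simp add: binomial_eq_0)
  finally show ?thesis .
qed

text \<open>
  A vertex of weight \<open>a\<close> is the top of \<open>a choose k\<close> cubes of dimension \<open>k\<close>, hence contributes
  \<open>(1 + x)\<^sup>a\<close>.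
\<close>

theorem cube_poly_daisy: "cube_poly G = (\<Sum>w\<in>V. (1 + monom 1 1) ^ weight w)"
  by (rule poly_eqI) (simp add: coeff_cube_poly cube_count_daisy coeff_sum coeff_one_plus_x_power del: One_nat_def)

text \<open>
  With distances recorded, a top of weight \<open>a\<close> contributes the sum of
  \<open>(a choose k) x\<^sup>k q\<^sup>a\<^sup>-\<^sup>k\<close>, that is \<open>(x + q)\<^sup>a\<close>.
\<close>

theorem dist_cube_poly_daisy: "dist_cube_poly n G = (\<Sum>w\<in>V. (var_x + var_q) ^ weight w)"
proof -
  define N where "N a = card {w \<in> V. weight w = a}" for a
  let ?t = "\<lambda>k d. of_nat (cube_dist_count n G k d) * var_x ^ k * var_q ^ d"
  have N_0: "N a = 0" if "a > n" for a
  proof -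
    have "{w \<in> V. weight w = a} = {}" using weight_le that by fastforce
    then show ?thesis by (simp only: N_def card.empty)
  qed
  have t_0: "?t k d = 0" if "k + d > n" for k d
    using N_0[of "d + k"] that by (simp add: cube_dist_count_daisy N_def add.commute)
  have inner: "Sum_any (\<lambda>d. ?t k d) = (\<Sum>d\<le>n. ?t k d)" for k
  proof (rule Sum_any.expand_superset)
    show "{d. ?t k d \<noteq> 0} \<subseteq> {..n}"
    proof
      fix d assume "d \<in> {d. ?t k d \<noteq> 0}"
      then have "\<not> k + d > n" using t_0[of k d] by blast
      then show "d \<in> {..n}" by simp
    qed
  qed simp
  have "(\<Sum>d\<le>n. ?t k d) = 0" if "k > n" for k
    by (intro sum.neutral ballI t_0) (use that in simp)
  then have "dist_cube_poly n G = (\<Sum>k\<le>n. \<Sum>d\<le>n. ?t k d)"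
    unfolding dist_cube_poly_def inner
    by (intro Sum_any.expand_superset) (use not_le in blast)+
  also have "\<dots> = (\<Sum>(k, d)\<in>{..n} \<times> {..n}. ?t k d)"
    by (simp add: sum.cartesian_product)
  \<comment> \<open>The cubes are now grouped by the weight \<open>k + d\<close> of their top.\<close>
  also have "\<dots> = (\<Sum>(k, d)\<in>{(k, d). k + d \<le> n}. ?t k d)"
    by (rule sum.mono_neutral_right) (auto intro!: t_0)
  also have "\<dots> = (\<Sum>a\<le>n. \<Sum>k\<le>a. ?t k (a - k))"
    by (rule sum.triangle_reindex_eq)
  also have "\<dots> = (\<Sum>a\<le>n. of_nat (N a) * (var_x + var_q) ^ a)"
    by (intro sum.cong refl)
       (simp add: binomial_ring sum_distrib_left cube_dist_count_daisy N_def mult.assoc)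
  also have "\<dots> = (\<Sum>w\<in>V. (var_x + var_q) ^ weight w)"
    unfolding N_def by (rule sum_weights[symmetric])
  finally show ?thesis .
qed

end

section \<open>Fibonacci cubes\<close>

lemma fib_string_iff_nth:
  "fib_string p w \<longleftrightarrow> \<not> (\<exists>i. i + p \<le> length w \<and> (\<forall>j<p. w ! (i + j)))"
proof -
  have "sublist (replicate p True) w \<longleftrightarrow> (\<exists>i. i + p \<le> length w \<and> (\<forall>j<p. w ! (i + j)))" (is "?L \<longleftrightarrow> ?R")
  proof
    assume ?L
    then obtain xs ys where "w = xs @ replicate p True @ ys"
      by (auto simp: sublist_def)
    then show ?R by (intro exI[of _ "length xs"]) (auto simp: nth_append)
  next
    assume ?R
    then obtain i where i: "i + p \<le> length w" "\<forall>j<p. w ! (i + j)" by blast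
    have "take p (drop i w) = replicate p True"
      using i by (intro nth_equalityI) auto
    then show ?L
      by (metis sublist_take sublist_drop sublist_order.order_trans)
  qed
  then show ?thesis by (simp add: fib_string_def)
qed

lemma fib_string_mono:
  assumes "fib_string p w" "length u = length w" "ones u \<subseteq> ones w"
  shows "fib_string p u"
  unfolding fib_string_iff_nth
proof
  assume "\<exists>i. i + p \<le> length u \<and> (\<forall>j<p. u ! (i + j))"
  then obtain i where i: "i + p \<le> length u" "\<forall>j<p. u ! (i + j)" by blast
  have "w ! (i + j)" if "j < p" for j
  proof -
    have "i + j \<in> ones u" using i that by (auto simp: ones_def)
    then show ?thesis using assms(3) by (auto simp: ones_def)
  qed
  then show False using assms(1,2) i(1) by (auto simp: fib_string_iff_nth)
qed

abbreviation fib_strings :: "nat \<Rightarrow> nat \<Rightarrow> bool list set" where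
  "fib_strings p n \<equiv> {w. length w = n \<and> fib_string p w}"

lemma fib_cube_eq: "fib_cube p n = hypercube n \<restriction> fib_strings p n"
  by (simp add: fib_cube_def)

lemma daisy_cube_fib_strings: "daisy_cube n (fib_strings p n)"
  by unfold_locales (auto intro: fib_string_mono)

lemma top_weight_le:
  fixes p n :: nat
  assumes "p \<ge> 1"
  shows "(n + 1) * (p - 1) div p \<le> n"
proof -
  have "(n + 1) * (p - 1) < (n + 1) * p"
    using assms by (intro mult_strict_left_mono) auto
  then have "(n + 1) * (p - 1) div p < n + 1"
    by (rule less_mult_imp_div_less)
  then show ?thesis by simp
qed

text \<open>
  The cube counts and both polynomials are sums over the vertices of a function of the weight.
  Grouping by weight brings in the \<open>p\<close>-nomial coefficients, which vanish beyond
  the stated upper limit.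
\<close>

lemma sum_fib_strings:
  fixes f :: "nat \<Rightarrow> 'a :: comm_semiring_1"
  assumes "p \<ge> 1"
  shows "(\<Sum>w\<in>fib_strings p n. f (weight w))
    = (\<Sum>a = 0..(n + 1) * (p - 1) div p. of_nat (pnomial p (n + 1 - a) a) * f a)"
proof -
  interpret daisy_cube n "fib_strings p n" by (rule daisy_cube_fib_strings)
  let ?M = "(n + 1) * (p - 1) div p"
  have "?M \<le> n"
    by (rule top_weight_le[OF assms])
  have "(\<Sum>w\<in>fib_strings p n. f (weight w))
      = (\<Sum>a\<le>n. of_nat (card {w \<in> fib_strings p n. weight w = a}) * f a)"
    by (rule sum_weights)
  also have "\<dots> = (\<Sum>a\<le>n. of_nat (pnomial p (n + 1 - a) a) * f a)"
    using card_fib_strings[OF assms] by (intro sum.cong refl) (simp add: conj_assoc)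
  also have "\<dots> = (\<Sum>a = 0..?M. of_nat (pnomial p (n + 1 - a) a) * f a)"
  proof (intro sum.mono_neutral_right ballI)
    fix a assume "a \<in> {..n} - {0..?M}"
    then have "pnomial p (n + 1 - a) a = 0"
      by (subst pnomial_diff_eq_0_iff[OF assms]) auto
    then show "of_nat (pnomial p (n + 1 - a) a) * f a = 0"
      by (simp only: of_nat_0 mult_zero_left)
  qed (use \<open>?M \<le> n\<close> in auto)
  finally show ?thesis .
qed

theorem theorem6p5:
  fixes p n :: nat
  assumes "p \<ge> 2"
  shows "degree (cube_poly (fib_cube p n)) = (n + 1) * (p - 1) div p
    \<and> cube_poly (fib_cube p n)
        = (\<Sum>a = 0..(n + 1) * (p - 1) div p. of_nat (pnomial p (n + 1 - a) a) * (1 + monom 1 1) ^ a)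
    \<and> dist_cube_poly n (fib_cube p n)
        = (\<Sum>a = 0..(n + 1) * (p - 1) div p. of_nat (pnomial p (n + 1 - a) a) * (var_x + var_q) ^ a)
    \<and> (\<forall>k. cube_count (fib_cube p n) k
        = (\<Sum>a = k..(n + 1) * (p - 1) div p. pnomial p (n + 1 - a) a * (a choose k)))
    \<and> (\<forall>k d. d + k \<le> n + 1 \<longrightarrow>
        cube_dist_count n (fib_cube p n) k d
          = pnomial p (n + 1 - d - k) (d + k) * ((d + k) choose k))"
proof -
  interpret daisy_cube n "fib_strings p n" by (rule daisy_cube_fib_strings)
  let ?M = "(n + 1) * (p - 1) div p"
  let ?P = "\<lambda>a. pnomial p (n + 1 - a) a"
  have p: "p \<ge> 1" using assms by simp
  have count: "cube_count G k = (\<Sum>a = k..?M. ?P a * (a choose k))" for k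
  proof -
    have "cube_count G k = (\<Sum>a = 0..?M. ?P a * (a choose k))"
      using sum_fib_strings[OF p, of "\<lambda>a. a choose k" n] by (simp add: cube_count_daisy)
    also have "\<dots> = (\<Sum>a = k..?M. ?P a * (a choose k))"
      by (intro sum.mono_neutral_right) auto
    finally show ?thesis .
  qed
  have "degree (cube_poly G) = ?M"
  proof (rule antisym)
    show "degree (cube_poly G) \<le> ?M"
      by (rule degree_le) (simp add: coeff_cube_poly count)
    have "?P ?M \<noteq> 0"
      using top_weight_le[OF p, of n] pnomial_diff_eq_0_iff[OF p, of ?M "n + 1"] by simp
    then show "?M \<le> degree (cube_poly G)"
      by (intro le_degree) (simp add: coeff_cube_poly count)
  qed
  moreover have "cube_poly G = (\<Sum>a = 0..?M. of_nat (?P a) * (1 + monom 1 1) ^ a)"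
    unfolding cube_poly_daisy by (rule sum_fib_strings[OF p])
  moreover have "dist_cube_poly n G = (\<Sum>a = 0..?M. of_nat (?P a) * (var_x + var_q) ^ a)"
    unfolding dist_cube_poly_daisy by (rule sum_fib_strings[OF p])
  moreover have "cube_dist_count n G k d = pnomial p (n + 1 - d - k) (d + k) * ((d + k) choose k)"
    if "d + k \<le> n + 1" for k d
    using card_fib_strings[OF p that] by (simp add: cube_dist_count_daisy conj_assoc)
  ultimately show ?thesis
    unfolding fib_cube_eq using count by blast
qed

end
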